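(* Let $U$ be a finite-dimensional Hilbert space over $\mathbb K\in\{\mathbb R,\mathbb C\}$ with dual $U'$, let $A:U\to U'$ and $P:U'\to U$ be linear operators, let $b\in U'$, let $u\in U$ be the solution of $Au=b$, and put $E:=I-PA$. Let $U_r\subset U$ be an $r$-dimensional subspace and assume that $\|E\|_{U_r,U_r}<1$. Then, for $u_r\in U_r$ the solution of the preconditioned Galerkin system $\|\Pi_{U_r}PA(u-u_r)\|_U=0$, it holds $$\|u-u_r\|_U\ \le\ \Big(1+\frac{\|E\|_{U,U_r}}{1-\|E\|_{U_r,U_r}}\Big)\,\|u-\Pi_{U_r}u\|_U .$$
   Context: $\Pi_{\tilde U}:U\to\tilde U$ denotes the orthogonal projector onto a subspace $\tilde U\subset U$. For a linear operator $G:U\to U$, $\|G\|_{op}=\max_{v\in U\setminus\{0\}}\|Gv\|_U/\|v\|_U$, and for subspaces $\tilde V,\tilde W\subset U$, $\|G\|_{\tilde V,\tilde W}:=\|\Pi_{\tilde W}G\,\Pi_{\tilde V}\|_{op}$ (a seminorm). In particular $\|G\|_{U,U_r}=\|\Pi_{U_r}G\|_{op}$. *)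

theory Defs
  imports "HOL-Analysis.Analysis" "HOL-Library.Function_Algebras"
begin

text \<open>
  The scalar field is \<open>\<real>\<close> or \<open>\<complex>\<close>. Both are instances of the class below, and the lemma
  \<open>real_or_complex_cases\<close> shows that there are no others: every instance either consists of
  real scalars only, or is spanned over the reals by 1 and a square root of -1.
\<close>

class real_or_complex = real_normed_field +
  fixes kcnj :: "'a \<Rightarrow> 'a"
  assumes kcnj_add: "kcnj (x + y) = kcnj x + kcnj y"
    and kcnj_mult: "kcnj (x * y) = kcnj x * kcnj y"
    and mult_kcnj_scaleR: "x * kcnj x = (norm x)\<^sup>2 *\<^sub>R 1"

instantiation real :: real_or_complex
begin
definition kcnj_real :: "real \<Rightarrow> real" where "kcnj_real x = x"
instance
  by standard (auto simp: kcnj_real_def power2_eq_square)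
end

instantiation complex :: real_or_complex
begin
definition kcnj_complex :: "complex \<Rightarrow> complex" where "kcnj_complex = cnj"
instance
  by standard (auto simp: kcnj_complex_def scaleR_conv_of_real simp flip: complex_norm_square)
end

lemma mult_kcnj: "x * kcnj x = of_real ((norm x)\<^sup>2)"
  by (simp add: mult_kcnj_scaleR of_real_def)

lemma kcnj_of_real: "kcnj (of_real r) = (of_real r :: 'k::real_or_complex)"
proof (cases "r = 0")
  case True
  have "kcnj 0 + kcnj 0 = kcnj (0::'k)"
    using kcnj_add[of "0::'k" 0] by simp
  then show ?thesis using True by simp
next
  case False
  have "of_real r * kcnj (of_real r) = (of_real r * of_real r :: 'k)"
    using mult_kcnj[of "of_real r :: 'k"] by (simp add: power2_eq_square)
  then show ?thesis using False by simp
qed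

lemma real_or_complex_split:
  fixes x :: "'k::real_or_complex"
  obtains a w where "x = of_real a + w" "w * w = - (of_real ((norm w)\<^sup>2))"
proof -
  have one: "kcnj (1::'k) = 1"
    using kcnj_of_real[of 1, where 'k='k] by simp
  have "(x + 1) * kcnj (x + 1) = x * kcnj x + (x + kcnj x) + 1"
    by (simp add: kcnj_add one algebra_simps)
  then have "x + kcnj x = of_real ((norm (x + 1))\<^sup>2 - (norm x)\<^sup>2 - 1)"
    by (simp add: mult_kcnj algebra_simps)
  then obtain t where t: "x + kcnj x = of_real t" by blast
  define w where "w = x - of_real (t / 2)"
  have "kcnj x = kcnj w + of_real (t / 2)"
    using kcnj_add[of w "of_real (t / 2)"] kcnj_of_real[of "t / 2", where 'k='k]
    by (simp add: w_def)
  moreover have "x = w + of_real (t / 2)"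
    by (simp add: w_def)
  moreover have "of_real (t / 2) + of_real (t / 2) = (of_real t :: 'k)"
    unfolding of_real_add[symmetric] by simp
  ultimately have "w + kcnj w = 0"
    using t by (metis add.assoc add.commute add_cancel_right_left)
  then have "kcnj w = - w"
    by (simp add: eq_neg_iff_add_eq_0 add.commute)
  then have "w * w = - (of_real ((norm w)\<^sup>2))"
    using mult_kcnj[of w] by (metis minus_minus mult_minus_right)
  then show thesis using that[of "t / 2" w] by (simp add: w_def)
qed

lemma real_or_complex_cases:
  "(\<forall>x::'k::real_or_complex. x \<in> \<real>) \<or>
   (\<exists>i::'k. i * i = - 1 \<and> (\<forall>x. \<exists>a b. x = of_real a + of_real b * i))"
proof (rule disjCI)
  assume "\<not> (\<exists>i::'k. i * i = - 1 \<and> (\<forall>x. \<exists>a b. x = of_real a + of_real b * i))"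
  then have no: "\<not> (\<forall>x. \<exists>a b. x = of_real a + of_real b * i)" if "i * i = - 1" for i :: 'k
    using that by blast
  show "\<forall>x::'k. x \<in> \<real>"
  proof (rule ccontr)
    assume "\<not> (\<forall>x::'k. x \<in> \<real>)"
    then obtain y :: 'k where y: "y \<notin> \<real>" by blast
    obtain c v where v: "y = of_real c + v" "v * v = - (of_real ((norm v)\<^sup>2))"
      by (rule real_or_complex_split)
    have nz: "norm v \<noteq> 0" using y v by auto
    define i where "i = v / of_real (norm v)"
    have "i * i = (v * v) / of_real ((norm v)\<^sup>2)"
      by (simp add: i_def power2_eq_square)
    also have "\<dots> = - 1"
      unfolding v(2) using nz by simp
    finally have ii: "i * i = - 1" .
    have "\<exists>a b. x = of_real a + of_real b * i" for x
    proof -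
      obtain a w where w: "x = of_real a + w" "w * w = - (of_real ((norm w)\<^sup>2))"
        by (rule real_or_complex_split)
      have "(of_real (norm w) * i) * (of_real (norm w) * i) = of_real ((norm w)\<^sup>2) * (i * i)"
        by (simp add: power2_eq_square)
      then have "w * w = (of_real (norm w) * i) * (of_real (norm w) * i)"
        using w(2) ii by simp
      then have "w = of_real (norm w) * i \<or> w = - (of_real (norm w) * i)"
        by (simp only: square_eq_iff)
      then have "w = of_real (norm w) * i \<or> w = of_real (- norm w) * i"
        by simp
      then show ?thesis using w(1) by metis
    qed
    then show False using no[OF ii] by blast
  qed
qed

text \<open>
  The inner product is linear in the second and conjugate-linear in the first argument. The
  norm of the type is the one induced by the inner product; positive definiteness of \<open>ip\<close>
  follows from \<open>ip_self\<close>, and completeness from \<open>finite_dim\<close>.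
\<close>

locale findim_hilbert_space = vector_space smul
  for smul :: "'k::real_or_complex \<Rightarrow> 'u::real_normed_vector \<Rightarrow> 'u" +
  fixes ip :: "'u \<Rightarrow> 'u \<Rightarrow> 'k"
  assumes smul_of_real: "smul (of_real c) x = c *\<^sub>R x"
    and ip_add_right: "ip x (y + z) = ip x y + ip x z"
    and ip_smul_right: "ip x (smul a y) = a * ip x y"
    and ip_commute: "ip x y = kcnj (ip y x)"
    and ip_self: "ip x x = of_real ((norm x)\<^sup>2)"
    and finite_dim: "\<exists>B. finite B \<and> span B = UNIV"

definition dual :: "('k::field \<Rightarrow> 'u::ab_group_add \<Rightarrow> 'u) \<Rightarrow> ('u \<Rightarrow> 'k) set" where
  "dual smul = {f. Vector_Spaces.linear smul (*) f}"

text \<open>Addition of functionals is the pointwise one provided by \<open>Function_Algebras\<close>.\<close>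

definition scale_fun :: "'k::field \<Rightarrow> ('u \<Rightarrow> 'k) \<Rightarrow> ('u \<Rightarrow> 'k)" where
  "scale_fun c f = (\<lambda>x. c * f x)"

lemma vector_space_scale_fun: "vector_space (scale_fun :: 'k::field \<Rightarrow> ('u \<Rightarrow> 'k) \<Rightarrow> ('u \<Rightarrow> 'k))"
  by unfold_locales (auto simp: scale_fun_def fun_eq_iff algebra_simps)

definition linear_into_dual ::
    "('k::field \<Rightarrow> 'u::ab_group_add \<Rightarrow> 'u) \<Rightarrow> ('u \<Rightarrow> 'u \<Rightarrow> 'k) \<Rightarrow> bool" where
  "linear_into_dual smul A \<longleftrightarrow>
     Vector_Spaces.linear smul scale_fun A \<and> (\<forall>v. A v \<in> dual smul)"

text \<open>Nothing is required of \<open>P\<close> on functions that are not linear functionals.\<close>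

definition linear_from_dual ::
    "('k::field \<Rightarrow> 'u::ab_group_add \<Rightarrow> 'u) \<Rightarrow> (('u \<Rightarrow> 'k) \<Rightarrow> 'u) \<Rightarrow> bool" where
  "linear_from_dual smul P \<longleftrightarrow>
     (\<forall>f\<in>dual smul. \<forall>g\<in>dual smul. P (f + g) = P f + P g) \<and>
     (\<forall>c. \<forall>f\<in>dual smul. P (scale_fun c f) = smul c (P f))"

definition orth_proj :: "('u::ab_group_add \<Rightarrow> 'u \<Rightarrow> 'k::zero) \<Rightarrow> 'u set \<Rightarrow> 'u \<Rightarrow> 'u" where
  "orth_proj ip W x = (THE y. y \<in> W \<and> (\<forall>w\<in>W. ip w (x - y) = 0))"

text \<open>
  \<open>onorm G\<close> is the supremum of \<open>norm (G v) / norm v\<close>, where \<open>v = 0\<close> contributes the value 0.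
  For linear \<open>G\<close> on a nonzero finite-dimensional space this is the maximum over \<open>v \<noteq> 0\<close>.
\<close>

definition op_seminorm ::
    "('u::real_normed_vector \<Rightarrow> 'u \<Rightarrow> 'k::zero) \<Rightarrow> ('u \<Rightarrow> 'u) \<Rightarrow> 'u set \<Rightarrow> 'u set \<Rightarrow> real" where
  "op_seminorm ip G V W = onorm (orth_proj ip W \<circ> G \<circ> orth_proj ip V)"

lemma orth_proj_UNIV:
  assumes "findim_hilbert_space smul ip"
  shows "orth_proj ip UNIV x = x"
proof -
  interpret findim_hilbert_space smul ip by fact
  have zero: "ip w 0 = 0" for w
    using ip_add_right[of w 0 0] by simp
  show ?thesis
    unfolding orth_proj_def
  proof (rule the_equality)
    fix y assume "y \<in> UNIV \<and> (\<forall>w\<in>UNIV. ip w (x - y) = 0)"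
    then have "ip (x - y) (x - y) = 0" by blast
    then show "y = x" by (simp add: ip_self)
  qed (simp add: zero)
qed

end

theory Submission
  imports Defs
begin

text \<open>
  Write \<open>\<Pi>\<close> for the orthogonal projector onto \<open>U\<^sub>r\<close>, and let
  \<open>e = \<Pi> u - u\<^sub>r\<close>, the part of the error that lies in \<open>U\<^sub>r\<close>. As \<open>P A = I - E\<close>, the
  preconditioned Galerkin system reads \<open>\<Pi> (u - u\<^sub>r) = \<Pi> E (u - u\<^sub>r)\<close>. The left side is \<open>e\<close>, and
  splitting \<open>u - u\<^sub>r = (u - \<Pi> u) + e\<close> on the right gives the fixed-point equation
  \<open>e = \<Pi> E (u - \<Pi> u) + \<Pi> E \<Pi> e\<close>. Taking norms and absorbing the last term, whose factor
  \<open>\<parallel>E\<parallel>\<close> from \<open>U\<^sub>r\<close> to \<open>U\<^sub>r\<close> is smaller than 1, bounds \<open>norm e\<close> by a multiple of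
  \<open>norm (u - \<Pi> u)\<close>; the triangle inequality finishes the proof.

  This argument needs two facts about finite-dimensional spaces. The projector, introduced by a
  definite description, must exist (\<open>orth_proj_props\<close>). And linear maps must be bounded
  (\<open>linear_imp_bounded_linear\<close>), because only then does \<open>onorm\<close> bound the quotients
  \<open>norm (G v) / norm v\<close>. Both are proved by adjoining one vector at a time to a finite spanning
  set, replacing it by its component orthogonal to the span reached so far (a Gram--Schmidt step).
\<close>

section \<open>Inner product and norm\<close>

context findim_hilbert_space
begin

lemma kcnj_zero: "kcnj (0::'k) = 0"
  using kcnj_of_real[of 0, where 'k='k] by simp

lemma ip_add_left: "ip (x + y) z = ip x z + ip y z"
  using ip_commute[of "x + y" z] ip_commute[of x z] ip_commute[of y z]
  by (simp only: ip_add_right kcnj_add)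

lemma ip_smul_left: "ip (smul a x) z = kcnj a * ip x z"
  using ip_commute[of "smul a x" z] ip_commute[of x z]
  by (simp only: ip_smul_right kcnj_mult)

lemma ip_zero_right: "ip x 0 = 0"
  using ip_add_right[of x 0 0] by simp

lemma ip_zero_left: "ip 0 x = 0"
  using ip_add_left[of 0 0 x] by simp

lemma ip_diff_right: "ip x (y - z) = ip x y - ip x z"
  using ip_add_right[of x "y - z" z] by (simp add: algebra_simps)

lemma ip_self_eq_0_iff: "ip x x = 0 \<longleftrightarrow> x = 0"
  by (simp add: ip_self)

lemma norm_smul: "norm (smul a x) = norm a * norm x"
proof -
  have "(of_real ((norm (smul a x))\<^sup>2) :: 'k) = (a * kcnj a) * ip x x"
    unfolding ip_self[symmetric] by (simp add: ip_smul_left ip_smul_right)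
  also have "\<dots> = of_real ((norm a * norm x)\<^sup>2)"
    by (simp add: mult_kcnj ip_self power_mult_distrib)
  finally have "(norm (smul a x))\<^sup>2 = (norm a * norm x)\<^sup>2"
    by (simp only: of_real_eq_iff)
  then show ?thesis by (simp add: power2_eq_iff_nonneg)
qed

lemma pythagoras:
  assumes "ip x y = 0"
  shows "(norm (x + y))\<^sup>2 = (norm x)\<^sup>2 + (norm y)\<^sup>2"
proof -
  have "ip y x = 0"
    using assms ip_commute[of y x] kcnj_zero by simp
  then have "(of_real ((norm (x + y))\<^sup>2) :: 'k) = of_real ((norm x)\<^sup>2 + (norm y)\<^sup>2)"
    unfolding of_real_add ip_self[symmetric] using assms
    by (simp add: ip_add_left ip_add_right)
  then show ?thesis by (simp only: of_real_eq_iff)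
qed

section \<open>Orthogonal projectors\<close>

lemma orthogonal_span:
  assumes "\<And>w. w \<in> B \<Longrightarrow> ip w z = 0" and "w \<in> span B"
  shows "ip w z = 0"
  using assms(2)
proof (induction rule: span_induct_alt)
  case base
  show ?case by (rule ip_zero_left)
next
  case (step c x y)
  then show ?case using assms(1) by (simp add: ip_add_left ip_smul_left)
qed

text \<open>
  If \<open>y\<close> is the projection of \<open>x\<close> onto the span of \<open>B\<close>, then adding to \<open>y\<close> the projection of
  \<open>x\<close> onto the line through \<open>d\<close>, the part of \<open>b\<close> orthogonal to that span, gives the projection
  onto the span of \<open>insert b B\<close>.
\<close>

lemma exists_projection_span:
  assumes "finite B"
  shows "\<exists>y\<in>span B. \<forall>w\<in>span B. ip w (x - y) = 0"
  using assms
proof (induction arbitrary: x)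
  case empty
  show ?case by (auto simp: ip_zero_left)
next
  case (insert b B)
  obtain q where q: "q \<in> span B" "\<And>w. w \<in> span B \<Longrightarrow> ip w (b - q) = 0"
    using insert.IH[of b] by blast
  obtain y where y: "y \<in> span B" "\<And>w. w \<in> span B \<Longrightarrow> ip w (x - y) = 0"
    using insert.IH[of x] by blast
  define d where "d = b - q"
  \<comment> \<open>If \<open>b\<close> already lies in the span of \<open>B\<close>, then \<open>d = 0\<close> and this coefficient is \<open>0 / 0 = 0\<close>.\<close>
  define c where "c = ip d x / ip d d"
  have cd: "c * ip d d = ip d x"
    by (cases "d = 0") (auto simp: c_def ip_self_eq_0_iff ip_zero_left)
  have mono: "span B \<subseteq> span (insert b B)"
    by (rule span_mono) auto
  have "d \<in> span (insert b B)"
    unfolding d_def using q(1) mono by (auto intro: span_diff span_base)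
  then have mem: "y + smul c d \<in> span (insert b B)"
    using y(1) mono by (auto intro: span_add span_scale)
  have Bz: "ip w (x - (y + smul c d)) = 0" if "w \<in> span B" for w
  proof -
    have "ip w (x - (y + smul c d)) = ip w (x - y) - c * ip w d"
      by (simp add: ip_diff_right ip_add_right ip_smul_right)
    then show ?thesis using y(2) q(2) that by (simp add: d_def)
  qed
  have "ip d y = 0"
    using q(2)[OF y(1)] ip_commute[of d y] kcnj_zero by (simp add: d_def)
  then have "ip d (x - (y + smul c d)) = 0"
    using cd by (simp add: ip_diff_right ip_add_right ip_smul_right)
  then have "ip (d + q) (x - (y + smul c d)) = 0"
    using Bz[OF q(1)] by (simp add: ip_add_left)
  then have "ip b (x - (y + smul c d)) = 0"
    by (simp add: d_def)
  then have "ip w (x - (y + smul c d)) = 0" if "w \<in> insert b B" for w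
    using Bz span_base that by blast
  then have "\<forall>w\<in>span (insert b B). ip w (x - (y + smul c d)) = 0"
    using orthogonal_span by blast
  then show ?case using mem by blast
qed

lemma subspace_finite_span:
  assumes "subspace W"
  obtains B where "finite B" "span B = W"
proof -
  obtain S where S: "finite S" "span S = UNIV"
    using finite_dim by blast
  obtain B where B: "B \<subseteq> W" "independent B" "W \<subseteq> span B"
    using maximal_independent_subset[of W] by blast
  have "finite B"
    using independent_span_bound[OF S(1) B(2)] S(2) by simp
  moreover have "span B = W"
    using B assms span_minimal by blast
  ultimately show thesis by (rule that)
qed

lemma orth_proj_unique:
  assumes "subspace W" "y \<in> W" "\<And>w. w \<in> W \<Longrightarrow> ip w (x - y) = 0"
  shows "orth_proj ip W x = y"
  unfolding orth_proj_def
proof (rule the_equality)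
  show "y \<in> W \<and> (\<forall>w\<in>W. ip w (x - y) = 0)"
    using assms by blast
next
  fix z assume z: "z \<in> W \<and> (\<forall>w\<in>W. ip w (x - z) = 0)"
  then have "y - z \<in> W" using assms by (auto intro: subspace_diff)
  then have "ip (y - z) ((x - z) - (x - y)) = 0"
    using z assms(3) by (simp add: ip_diff_right)
  then show "z = y" by (simp add: ip_self_eq_0_iff)
qed

lemma orth_proj_props:
  assumes "subspace W"
  shows "orth_proj ip W x \<in> W" and "w \<in> W \<Longrightarrow> ip w (x - orth_proj ip W x) = 0"
proof -
  obtain B where "finite B" "span B = W"
    using subspace_finite_span[OF assms] .
  then obtain y where "y \<in> W" "\<And>w. w \<in> W \<Longrightarrow> ip w (x - y) = 0"
    using exists_projection_span[of B x] by blast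
  moreover from this have "orth_proj ip W x = y"
    by (rule orth_proj_unique[OF assms])
  ultimately show "orth_proj ip W x \<in> W" "w \<in> W \<Longrightarrow> ip w (x - orth_proj ip W x) = 0"
    by auto
qed

lemma orth_proj_ident:
  assumes "subspace W" "x \<in> W"
  shows "orth_proj ip W x = x"
  by (rule orth_proj_unique) (simp_all add: assms ip_zero_right)

lemma linear_orth_proj:
  assumes "subspace W"
  shows "Vector_Spaces.linear smul smul (orth_proj ip W)"
proof (unfold_locales)
  let ?p = "orth_proj ip W"
  fix x y c
  have "ip w (x + y - (?p x + ?p y)) = 0" if "w \<in> W" for w
  proof -
    have "x + y - (?p x + ?p y) = (x - ?p x) + (y - ?p y)" by simp
    then show ?thesis
      using orth_proj_props(2)[OF assms that] by (simp only: ip_add_right) simp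
  qed
  then show "?p (x + y) = ?p x + ?p y"
    by (intro orth_proj_unique assms subspace_add orth_proj_props)
  have "ip w (smul c x - smul c (?p x)) = 0" if "w \<in> W" for w
    using orth_proj_props(2)[OF assms that]
    by (simp add: ip_smul_right flip: scale_right_diff_distrib)
  then show "?p (smul c x) = smul c (?p x)"
    by (intro orth_proj_unique assms subspace_scale orth_proj_props)
qed

section \<open>Boundedness of linear maps and operator seminorms\<close>

text \<open>
  The orthogonal splitting \<open>x = smul k d + z\<close>, with \<open>z\<close> in the smaller span and \<open>d\<close> orthogonal
  to it, makes both parts no longer than \<open>x\<close>. Hence adjoining \<open>d\<close> raises a nonnegative bound
  by at most \<open>norm (f d) / norm d\<close>.
\<close>

lemma linear_bounded_on_span:
  assumes f: "Vector_Spaces.linear smul smul f" and "finite B"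
  shows "\<exists>C. \<forall>x\<in>span B. norm (f x) \<le> C * norm x"
  using assms(2)
proof (induction)
  interpret f: Vector_Spaces.linear smul smul f by fact
  case empty
  show ?case by (auto simp: f.zero)
next
  interpret f: Vector_Spaces.linear smul smul f by fact
  case (insert b B)
  obtain C where C: "\<And>x. x \<in> span B \<Longrightarrow> norm (f x) \<le> C * norm x"
    using insert.IH by blast
  obtain q where q: "q \<in> span B" "\<And>w. w \<in> span B \<Longrightarrow> ip w (b - q) = 0"
    using exists_projection_span[OF insert.hyps(1), of b] by blast
  define d where "d = b - q"
  have "norm (f x) \<le> (norm (f d) / norm d + \<bar>C\<bar>) * norm x" if x_in: "x \<in> span (insert b B)" for x
  proof -
    obtain k where k: "x - smul k b \<in> span B"
      using x_in by (auto simp: span_breakdown_eq)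
    define z where "z = (x - smul k b) + smul k q"
    have z: "z \<in> span B"
      unfolding z_def using k q(1) by (intro span_add span_scale)
    have x: "x = z + smul k d"
      by (simp add: z_def d_def scale_right_diff_distrib)
    have "ip z (smul k d) = 0"
      using q(2)[OF z] by (simp add: d_def ip_smul_right)
    then have pyth: "(norm x)\<^sup>2 = (norm z)\<^sup>2 + (norm (smul k d))\<^sup>2"
      unfolding x by (rule pythagoras)
    have zx: "norm z \<le> norm x" and dx: "norm (smul k d) \<le> norm x"
      using pyth by (simp_all add: power2_le_imp_le)
    have "norm (f (smul k d)) = norm (f d) / norm d * norm (smul k d)"
      by (cases "d = 0") (auto simp: f.scale f.zero norm_smul)
    also have "\<dots> \<le> norm (f d) / norm d * norm x"
      using dx by (intro mult_left_mono) auto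
    finally have 1: "norm (f (smul k d)) \<le> norm (f d) / norm d * norm x" .
    have "norm (f z) \<le> C * norm z"
      by (rule C[OF z])
    also have "\<dots> \<le> \<bar>C\<bar> * norm x"
      using zx by (intro mult_mono) auto
    finally have 2: "norm (f z) \<le> \<bar>C\<bar> * norm x" .
    have "norm (f x) \<le> norm (f z) + norm (f (smul k d))"
      unfolding x f.add by (rule norm_triangle_ineq)
    then show ?thesis
      using 1 2 by (simp add: distrib_right)
  qed
  then show ?case by blast
qed

lemma linear_imp_bounded_linear:
  assumes f: "Vector_Spaces.linear smul smul f"
  shows "bounded_linear f"
proof -
  interpret f: Vector_Spaces.linear smul smul f by fact
  obtain S where S: "finite S" "span S = UNIV"
    using finite_dim by blast
  then obtain C where "\<And>x. norm (f x) \<le> C * norm x"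
    using linear_bounded_on_span[OF f S(1)] by auto
  then show ?thesis
    by (intro bounded_linear_intro[where K = C])
       (simp_all add: f.add mult.commute f.scale flip: smul_of_real)
qed

text \<open>
  The inner projector disappears on \<open>v\<close>. Boundedness of the composition is essential: the
  supremum in \<open>onorm\<close> would otherwise be an unspecified real number.
\<close>

lemma op_seminorm_bound:
  assumes G: "Vector_Spaces.linear smul smul G" and V: "subspace V" and W: "subspace W"
    and v: "v \<in> V"
  shows "norm (orth_proj ip W (G v)) \<le> op_seminorm ip G V W * norm v"
proof -
  have "Vector_Spaces.linear smul smul (orth_proj ip W \<circ> G \<circ> orth_proj ip V)"
    using linear_orth_proj[OF V] linear_orth_proj[OF W] G
    by (intro Vector_Spaces.linear_compose)
  then have "bounded_linear (orth_proj ip W \<circ> G \<circ> orth_proj ip V)"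
    by (rule linear_imp_bounded_linear)
  from onorm[OF this, of v] show ?thesis
    by (simp add: op_seminorm_def orth_proj_ident[OF V v])
qed

lemma linear_preconditioning_error:
  assumes A: "linear_into_dual smul A" and P: "linear_from_dual smul P"
  shows "Vector_Spaces.linear smul smul (\<lambda>v. v - P (A v))"
proof -
  interpret A: Vector_Spaces.linear smul scale_fun A
    using A by (simp add: linear_into_dual_def)
  have "A v \<in> dual smul" for v
    using A by (simp add: linear_into_dual_def)
  then have "P (A v + A w) = P (A v) + P (A w)" "P (scale_fun c (A v)) = smul c (P (A v))"
    for v w c
    using P by (auto simp: linear_from_dual_def)
  then show ?thesis
    by unfold_locales (simp_all add: A.add A.scale scale_right_diff_distrib)
qed

end

section \<open>Quasi-optimality of the preconditioned Galerkin projection\<close>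

theorem proposition4p4:
  fixes smul :: "'k::real_or_complex \<Rightarrow> 'u::real_normed_vector \<Rightarrow> 'u"
    and ip :: "'u \<Rightarrow> 'u \<Rightarrow> 'k"
    and A :: "'u \<Rightarrow> ('u \<Rightarrow> 'k)"
    and P :: "('u \<Rightarrow> 'k) \<Rightarrow> 'u"
    and b :: "'u \<Rightarrow> 'k"
    and u u\<^sub>r :: 'u
    and E :: "'u \<Rightarrow> 'u"
    and U\<^sub>r :: "'u set"
    and r :: nat
  assumes "findim_hilbert_space smul ip"
    and "linear_into_dual smul A"
    and "linear_from_dual smul P"
    and "b \<in> dual smul"
    and "A u = b"
    and "E = (\<lambda>v. v - P (A v))"
    and "module.subspace smul U\<^sub>r"
    and "vector_space.dim smul U\<^sub>r = r"
    and "op_seminorm ip E U\<^sub>r U\<^sub>r < 1"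
    and "u\<^sub>r \<in> U\<^sub>r"
    and "norm (orth_proj ip U\<^sub>r (P (A (u - u\<^sub>r)))) = 0"
  shows "norm (u - u\<^sub>r)
       \<le> (1 + op_seminorm ip E UNIV U\<^sub>r / (1 - op_seminorm ip E U\<^sub>r U\<^sub>r))
          * norm (u - orth_proj ip U\<^sub>r u)"
proof -
  interpret findim_hilbert_space smul ip by fact
  note W = \<open>module.subspace smul U\<^sub>r\<close>
  let ?p = "orth_proj ip U\<^sub>r"
  let ?a = "op_seminorm ip E UNIV U\<^sub>r" and ?c = "op_seminorm ip E U\<^sub>r U\<^sub>r"
  have E: "Vector_Spaces.linear smul smul E"
    unfolding assms(6) by (rule linear_preconditioning_error) fact+
  interpret E: Vector_Spaces.linear smul smul E by fact
  interpret p: Vector_Spaces.linear smul smul ?p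
    by (rule linear_orth_proj[OF W])
  define e where "e = ?p u - u\<^sub>r"
  have e: "e \<in> U\<^sub>r"
    unfolding e_def using W assms(10) by (intro subspace_diff orth_proj_props)
  have "?p (u - u\<^sub>r) = e"
    by (simp add: p.diff e_def orth_proj_ident[OF W assms(10)])
  moreover have "?p (P (A (u - u\<^sub>r))) = 0"
    using assms(11) by simp
  ultimately have "e = ?p (E (u - u\<^sub>r))"
    by (simp add: assms(6) p.diff)
  also have "u - u\<^sub>r = (u - ?p u) + e"
    by (simp add: e_def)
  finally have fixed_point: "e = ?p (E (u - ?p u)) + ?p (E e)"
    by (simp only: E.add p.add)
  have "norm e \<le> norm (?p (E (u - ?p u))) + norm (?p (E e))"
    by (subst fixed_point) (rule norm_triangle_ineq)
  also have "\<dots> \<le> ?a * norm (u - ?p u) + ?c * norm e"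
    by (intro add_mono op_seminorm_bound E W subspace_UNIV UNIV_I e)
  finally have "norm e * (1 - ?c) \<le> ?a * norm (u - ?p u)"
    by (simp add: algebra_simps)
  then have "norm e \<le> ?a / (1 - ?c) * norm (u - ?p u)"
    using assms(9) by (simp add: field_simps)
  moreover have "norm (u - u\<^sub>r) \<le> norm (u - ?p u) + norm e"
    using norm_triangle_ineq[of "u - ?p u" e] by (simp add: e_def)
  ultimately show ?thesis
    by (simp add: distrib_right)
qed

end
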